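(* Let $r\ge 2$, $\alpha_1,\dots,\alpha_r\in\mathbb{N}=\{1,2,\dots\}$, $p_2,\dots,p_r\in\mathbb{N}_0=\{0,1,2,\dots\}$, and $\mathbf{n}=(n_1,\dots,n_r)$ with $n_1,\dots,n_{r-1}\in\mathbb{N}_0$ and $n_r\in\mathbb{N}$. Consider the $r$-colour urn with $r\times r$ transition matrix $M=(M_{i,j})$ given by $M_{i,i}=-\alpha_i$ for $1\le i\le r$, $M_{i,i-1}=p_i\alpha_{i-1}$ for $2\le i\le r$, and $M_{i,j}=0$ otherwise, started with $n_i$ units of type $i$ for $i=1,\dots,r$. Let $\mathbf{X}_{\mathbf{n}}=(X_{\mathbf{n}}^{[1]},\dots,X_{\mathbf{n}}^{[r-1]})$ be the random vector of the numbers of units of type $1,\dots,r-1$ present at the moment when all units of type $r$ have been removed. Then the probability generating function $h_{\mathbf{n}}(\mathbf{v})=\mathbb{E}\big(\prod_{\ell=1}^{r-1}v_\ell^{X_{\mathbf{n}}^{[\ell]}}\big)$ is given by $$h_{\mathbf{n}}(\mathbf{v})=\int_{0}^{\infty}\big(g_{r}(t,\mathbf{v})\big)^{n_r-1}\,v_{r-1}^{p_r}\,\alpha_r\,n_r\,e^{-\alpha_r t}\prod_{\ell=1}^{r-1}\big(f_\ell(t,\mathbf{v})\big)^{n_\ell}\,dt,$$ where the functions $f_j$ are defined by $f_0(t,\mathbf{v})=1$ and $$f_j(t,\mathbf{v})=v_je^{-\alpha_j t}+\int_{0}^{t}\alpha_j e^{-\alpha_j u}\big(f_{j-1}(t-u,\mathbf{v})\big)^{p_j}\,du,\qquad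 j\ge 1,$$ and $g_j(t,\mathbf{v})=f_j(t,\mathbf{v})-v_je^{-\alpha_j t}$. (For $j=1$ the value of $p_1$ is irrelevant because $f_0=1$; and $g_r$ does not depend on $v_r$.)
   Context: Urn model: balls have $r$ types (colours). At each discrete step a ball is drawn uniformly at random, its type $i$ is inspected, and it is put back; then $M_{i,j}$ balls of type $j$ are added for each $j$ (a negative number meaning removal). Type-$i$ balls are counted in units of $\alpha_i$, i.e. $n_i$ units of type $i$ means $\alpha_i n_i$ balls of type $i$. Equivalently, from the state $(n_1,\dots,n_r)$ with $n_r\ge1$, type $i$ is selected with probability $\frac{\alpha_i n_i}{\alpha_1n_1+\dots+\alpha_rn_r}$; then $n_i$ is decreased by $1$ and, if $i\ge 2$, $n_{i-1}$ is increased by $p_i$. The process stops as soon as $n_r=0$. *)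

theory Defs
  imports "HOL-Probability.Probability"
begin

text \<open>Types are indexed by \<open>{1..r}\<close>; a state \<open>b\<close> gives the number \<open>b i\<close> of balls of type \<open>i\<close>.
  Values at indices outside \<open>{1..r}\<close> are never inspected.\<close>

text \<open>The balls of type \<open>i\<close> are labelled \<open>(i, k)\<close> with \<open>k < b i\<close>.\<close>

definition urn_draw :: "nat \<Rightarrow> (nat \<Rightarrow> nat) \<Rightarrow> nat pmf" where
  "urn_draw r b = map_pmf fst (pmf_of_set (SIGMA i:{1..r}. {..<b i}))"

definition urn_step :: "(nat \<Rightarrow> nat \<Rightarrow> int) \<Rightarrow> nat \<Rightarrow> (nat \<Rightarrow> nat) \<Rightarrow> (nat \<Rightarrow> nat) pmf" where
  "urn_step M r b = map_pmf (\<lambda>i j. nat (int (b j) + M i j)) (urn_draw r b)"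

text \<open>The law of the state at the first time when no ball of type \<open>r\<close> is left.
  It is a subprobability; mass can only be lost on the event that this never happens.\<close>

partial_function (spmf) urn_stopped ::
  "(nat \<Rightarrow> nat \<Rightarrow> int) \<Rightarrow> nat \<Rightarrow> (nat \<Rightarrow> nat) \<Rightarrow> (nat \<Rightarrow> nat) spmf" where
  "urn_stopped M r b =
     (if b r = 0 then return_spmf b
      else bind_spmf (spmf_of_pmf (urn_step M r b)) (urn_stopped M r))"

definition urn_matrix :: "nat \<Rightarrow> (nat \<Rightarrow> nat) \<Rightarrow> (nat \<Rightarrow> nat) \<Rightarrow> nat \<Rightarrow> nat \<Rightarrow> int" where
  "urn_matrix r \<alpha> p i j =
     (if 1 \<le> i \<and> i \<le> r \<and> j = i then - int (\<alpha> i)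
      else if 2 \<le> i \<and> i \<le> r \<and> j = i - 1 then int (p i * \<alpha> (i - 1))
      else 0)"

text \<open>One unit of type \<open>i\<close> consists of \<open>\<alpha> i\<close> balls. From a start with \<open>\<alpha> i * n i\<close> balls of each
  type \<open>i\<close>, all ball counts remain multiples of the respective \<open>\<alpha> i\<close>, so the division is exact.\<close>

definition urn_final_units ::
  "nat \<Rightarrow> (nat \<Rightarrow> nat) \<Rightarrow> (nat \<Rightarrow> nat) \<Rightarrow> (nat \<Rightarrow> nat) \<Rightarrow> (nat \<Rightarrow> nat) spmf" where
  "urn_final_units r \<alpha> p n =
     map_spmf (\<lambda>b l. b l div \<alpha> l) (urn_stopped (urn_matrix r \<alpha> p) r (\<lambda>i. \<alpha> i * n i))"

definition urn_pgf ::
  "nat \<Rightarrow> (nat \<Rightarrow> nat) \<Rightarrow> (nat \<Rightarrow> nat) \<Rightarrow> (nat \<Rightarrow> nat) \<Rightarrow> (nat \<Rightarrow> complex) \<Rightarrow> complex" where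
  "urn_pgf r \<alpha> p n v =
     (LINT X|measure_spmf (urn_final_units r \<alpha> p n). (\<Prod>l = 1..r - 1. v l ^ X l))"

primrec urn_f ::
  "(nat \<Rightarrow> nat) \<Rightarrow> (nat \<Rightarrow> nat) \<Rightarrow> (nat \<Rightarrow> complex) \<Rightarrow> nat \<Rightarrow> real \<Rightarrow> complex" where
  "urn_f \<alpha> p v 0 = (\<lambda>t. 1)"
| "urn_f \<alpha> p v (Suc j) = (\<lambda>t.
     v (Suc j) * complex_of_real (exp (- real (\<alpha> (Suc j)) * t)) +
     (LINT u:{0..t}|lborel.
        complex_of_real (real (\<alpha> (Suc j)) * exp (- real (\<alpha> (Suc j)) * u)) *
        urn_f \<alpha> p v j (t - u) ^ p (Suc j)))"

definition urn_g ::
  "(nat \<Rightarrow> nat) \<Rightarrow> (nat \<Rightarrow> nat) \<Rightarrow> (nat \<Rightarrow> complex) \<Rightarrow> nat \<Rightarrow> real \<Rightarrow> complex" where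
  "urn_g \<alpha> p v j t = urn_f \<alpha> p v j t - v j * complex_of_real (exp (- real (\<alpha> j) * t))"

end

theory Submission imports Defs begin

text \<open>In continuous time, units of type \<open>l\<close> die independently at rate \<open>\<alpha> l\<close> and \<open>urn_f \<alpha> p v l t\<close> is
  the generating function at time \<open>t\<close> of the progeny of one such unit, so that
  \<open>f\<^sub>l' = \<alpha>\<^sub>l (f\<^bsub>l-1\<^esub>\<^bsup>p\<^sub>l\<^esup> - f\<^sub>l)\<close>. Setting \<open>v r = 0\<close> turns \<open>f\<^sub>r\<close> into \<open>g\<^sub>r\<close>. Integrating the derivative of
  \<open>e\<^bsup>-\<alpha>\<^sub>r t\<^esup> \<Prod>\<^sub>l f\<^sub>l(t)\<^bsup>m\<^sub>l\<^esup>\<close> over \<open>(0, \<infinity>)\<close> shows that the claimed integral satisfies the one-step equation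
  of the urn, the boundary value at \<open>t = 0\<close> supplying the stopping condition. That equation has only
  one solution, because a suitable weighting of the units decreases with every draw.\<close>

section \<open>Draws counted in units, and a decreasing weight\<close>

text \<open>For \<open>n i = 0\<close> the subtraction truncates and the value describes no draw; in
  the equations below such terms carry the coefficient \<open>\<alpha> i * n i = 0\<close>. The
  guard \<open>2 \<le> i\<close> mirrors \<open>urn_matrix\<close>, so that the two dynamics agree
  as functions, index 0 included.\<close>

definition unit_step :: "(nat \<Rightarrow> nat) \<Rightarrow> (nat \<Rightarrow> nat) \<Rightarrow> nat \<Rightarrow> nat \<Rightarrow> nat" where
  "unit_step p n i j = (if j = i then n j - 1 else if 2 \<le> i \<and> j = i - 1 then n j + p i else n j)"

text \<open>A draw trades one factor \<open>\<phi> l\<close> for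
  \<open>\<phi> (l - 1) ^ p l\<close>. A unit of type 1 leaves nothing behind, which is what
  \<open>\<phi> 0 = 1\<close> encodes; \<open>urn_f\<close> satisfies this at level 0.\<close>

lemma prod_unit_step:
  fixes \<phi> :: "nat \<Rightarrow> 'a::comm_monoid_mult"
  assumes l: "l \<in> {1..r}" and 1: "l = 1 \<Longrightarrow> \<phi> 0 = 1"
  shows "(\<Prod>j=1..r. \<phi> j ^ unit_step p n l j) =
    \<phi> l ^ (n l - 1) * \<phi> (l - 1) ^ p l * (\<Prod>j\<in>{1..r} - {l}. \<phi> j ^ n j)"
proof -
  have "(\<Prod>j=1..r. \<phi> j ^ unit_step p n l j) =
      \<phi> l ^ (n l - 1) * (\<Prod>j\<in>{1..r} - {l}. \<phi> j ^ unit_step p n l j)"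
    using l by (subst prod.remove[of _ l]) (auto simp: unit_step_def)
  also have "(\<Prod>j\<in>{1..r} - {l}. \<phi> j ^ unit_step p n l j) =
      (\<Prod>j\<in>{1..r} - {l}. (if j = l - 1 then \<phi> (l - 1) ^ p l else 1) * \<phi> j ^ n j)"
    using l by (intro prod.cong) (auto simp: unit_step_def power_add mult.commute)
  also have "\<dots> = \<phi> (l - 1) ^ p l * (\<Prod>j\<in>{1..r} - {l}. \<phi> j ^ n j)"
    using l 1 by (cases "l = 1") (auto simp: prod.distrib)
  finally show ?thesis by (simp add: mult.assoc)
qed

text \<open>The weights are chosen such that every draw lowers the total weight by exactly \<open>1\<close>.\<close>

primrec unit_weight :: "(nat \<Rightarrow> nat) \<Rightarrow> nat \<Rightarrow> nat" where
  "unit_weight p 0 = 0"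
| "unit_weight p (Suc i) = 1 + p (Suc i) * unit_weight p i"

lemma sum_unit_weight_unit_step:
  assumes i: "i \<in> {1..r}" and n: "1 \<le> n i"
  shows "(\<Sum>j=1..r. unit_weight p j * unit_step p n i j) + 1 = (\<Sum>j=1..r. unit_weight p j * n j)"
proof -
  have w: "unit_weight p i = 1 + p i * unit_weight p (i - 1)"
    using i by (cases i) auto
  have "(\<Sum>j\<in>{1..r} - {i}. unit_weight p j * unit_step p n i j) =
      (\<Sum>j\<in>{1..r} - {i}. (if j = i - 1 then unit_weight p (i - 1) * p i else 0) + unit_weight p j * n j)"
    using i by (intro sum.cong) (auto simp: unit_step_def algebra_simps)
  \<comment> \<open>For \<open>i = 1\<close> no index of the sum equals \<open>i - 1\<close>, and
    \<open>unit_weight p 0 = 0\<close> makes the extracted term vanish.\<close>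
  also have "\<dots> = unit_weight p (i - 1) * p i + (\<Sum>j\<in>{1..r} - {i}. unit_weight p j * n j)"
    using i by (cases "i = 1") (auto simp: sum.distrib)
  finally have "(\<Sum>j=1..r. unit_weight p j * unit_step p n i j) =
      unit_weight p i * (n i - 1) + (unit_weight p (i - 1) * p i + (\<Sum>j\<in>{1..r} - {i}. unit_weight p j * n j))"
    using i by (subst sum.remove[of _ i]) (auto simp: unit_step_def)
  moreover have "(\<Sum>j=1..r. unit_weight p j * n j) =
      unit_weight p i * n i + (\<Sum>j\<in>{1..r} - {i}. unit_weight p j * n j)"
    using i by (subst sum.remove[of _ i]) auto
  moreover obtain k where "n i = Suc k" using n by (cases "n i") auto
  ultimately show ?thesis using w by (simp add: algebra_simps)
qed

section \<open>The stopped urn and uniqueness for its one-step equation\<close>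

lemma
  assumes b: "0 < (\<Sum>i=1..r. b i)"
  shows set_pmf_urn_draw: "set_pmf (urn_draw r b) = {i\<in>{1..r}. 0 < b i}"
    and pmf_urn_draw: "i \<in> {1..r} \<Longrightarrow> pmf (urn_draw r b) i = real (b i) / real (\<Sum>i=1..r. b i)"
proof -
  have fin: "finite (SIGMA i:{1..r}. {..<b i})" by auto
  have card: "card (SIGMA i:{1..r}. {..<b i}) = (\<Sum>i=1..r. b i)" by simp
  \<comment> \<open>The presence of a ball enters here: \<open>pmf_of_set\<close> is meaningful only
    for a nonempty set.\<close>
  have ne: "(SIGMA i:{1..r}. {..<b i}) \<noteq> {}" using b card by (metis card.empty less_irrefl)
  show "set_pmf (urn_draw r b) = {i\<in>{1..r}. 0 < b i}"
    using fin ne by (auto simp: urn_draw_def image_iff)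
  assume i: "i \<in> {1..r}"
  have "(SIGMA i:{1..r}. {..<b i}) \<inter> fst -` {i} = {i} \<times> {..<b i}" using i by auto
  then show "pmf (urn_draw r b) i = real (b i) / real (\<Sum>i=1..r. b i)"
    unfolding urn_draw_def pmf_map measure_pmf_of_set[OF ne fin] card by simp
qed

text \<open>A drawn type has at least one unit, hence at least \<open>\<alpha> i\<close> balls, so
  \<open>nat\<close> cuts nothing off. All reachable states thus keep the form
  \<open>\<alpha> j * n j\<close>, and the next induction can run over vectors of units.\<close>

lemma urn_matrix_add_units:
  assumes "i \<in> {1..r}" "1 \<le> n i"
  shows "(\<lambda>j. nat (int (\<alpha> j * n j) + urn_matrix r \<alpha> p i j)) = (\<lambda>j. \<alpha> j * unit_step p n i j)"
proof
  fix j
  obtain k where "n i = Suc k" using assms by (cases "n i") auto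
  then show "nat (int (\<alpha> j * n j) + urn_matrix r \<alpha> p i j) = \<alpha> j * unit_step p n i j"
    using assms by (auto simp: urn_matrix_def unit_step_def algebra_simps nat_add_distrib nat_mult_distrib simp flip: of_nat_mult of_nat_add)
qed

text \<open>Induction on the total weight, which every draw lowers. It shows simultaneously that the
  stopped law is a genuine \<open>pmf\<close>, so that no mass is lost, and that its support is
  finite, which settles integrability for every \<open>\<phi>\<close>. Assumption \<open>rec\<close>
  is the first-step equation multiplied by the total number of balls.\<close>

lemma urn_stopped_expectation_unique:
  fixes J :: "(nat \<Rightarrow> nat) \<Rightarrow> 'a::{banach, second_countable_topology}" and \<phi> :: "(nat \<Rightarrow> nat) \<Rightarrow> 'a"
  assumes r: "1 \<le> r" and \<alpha>: "\<And>i. i \<in> {1..r} \<Longrightarrow> 1 \<le> \<alpha> i"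
    and stop: "\<And>n. n r = 0 \<Longrightarrow> \<phi> (\<lambda>i. \<alpha> i * n i) = J n"
    and rec: "\<And>n. 1 \<le> n r \<Longrightarrow> real (\<Sum>i=1..r. \<alpha> i * n i) *\<^sub>R J n =
        (\<Sum>i=1..r. real (\<alpha> i * n i) *\<^sub>R J (unit_step p n i))"
  shows "(LINT b|measure_spmf (urn_stopped (urn_matrix r \<alpha> p) r (\<lambda>i. \<alpha> i * n i)). \<phi> b) = J n"
proof -
  have "\<exists>q. urn_stopped (urn_matrix r \<alpha> p) r (\<lambda>i. \<alpha> i * n i) = spmf_of_pmf q \<and> finite (set_pmf q) \<and>
      measure_pmf.expectation q \<phi> = J n"
  proof (induction "\<Sum>j=1..r. unit_weight p j * n j" arbitrary: n rule: less_induct)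
    case less
    show ?case
    proof (cases "n r = 0")
      case True
      then show ?thesis
        by (intro exI[of _ "return_pmf (\<lambda>i. \<alpha> i * n i)"]) (simp add: urn_stopped.simps stop)
    next
      case False
      define b where "b = (\<lambda>i. \<alpha> i * n i)"
      define D where "D = set_pmf (urn_draw r b)"
      define N where "N = (\<Sum>i=1..r. \<alpha> i * n i)"
      have br: "b r \<noteq> 0" using False \<alpha>[of r] r by (auto simp: b_def)
      have "b r \<le> (\<Sum>i=1..r. b i)" using r by (intro member_le_sum) auto
      then have N: "0 < N" using br unfolding N_def b_def by linarith
      have D: "D = {i\<in>{1..r}. 0 < b i}"
        unfolding D_def using N by (intro set_pmf_urn_draw) (simp add: N_def b_def)
      have "\<forall>i\<in>D. \<exists>q. urn_stopped (urn_matrix r \<alpha> p) r (\<lambda>j. \<alpha> j * unit_step p n i j) = spmf_of_pmf q \<and>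
          finite (set_pmf q) \<and> measure_pmf.expectation q \<phi> = J (unit_step p n i)"
      proof
        fix i assume "i \<in> D"
        then have i: "i \<in> {1..r}" "1 \<le> n i" by (auto simp: D b_def)
        show "\<exists>q. urn_stopped (urn_matrix r \<alpha> p) r (\<lambda>j. \<alpha> j * unit_step p n i j) = spmf_of_pmf q \<and>
          finite (set_pmf q) \<and> measure_pmf.expectation q \<phi> = J (unit_step p n i)"
          using sum_unit_weight_unit_step[where p = p and n = n, OF i] by (intro less) linarith
      qed
      then obtain q where q: "\<And>i. i \<in> D \<Longrightarrow>
            urn_stopped (urn_matrix r \<alpha> p) r (\<lambda>j. \<alpha> j * unit_step p n i j) = spmf_of_pmf (q i)"
          "\<And>i. i \<in> D \<Longrightarrow> finite (set_pmf (q i))"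
          "\<And>i. i \<in> D \<Longrightarrow> measure_pmf.expectation (q i) \<phi> = J (unit_step p n i)"
        by metis
      have "urn_stopped (urn_matrix r \<alpha> p) r b =
          bind_pmf (urn_draw r b)
            (\<lambda>i. urn_stopped (urn_matrix r \<alpha> p) r (\<lambda>j. nat (int (b j) + urn_matrix r \<alpha> p i j)))"
        using br by (subst urn_stopped.simps) (simp add: urn_step_def bind_map_pmf)
      also have "\<dots> = bind_pmf (urn_draw r b) (\<lambda>i. spmf_of_pmf (q i))"
      proof (rule bind_pmf_cong[OF refl])
        fix i assume "i \<in> set_pmf (urn_draw r b)"
        then have i: "i \<in> D" by (simp add: D_def)
        then have "i \<in> {1..r}" "1 \<le> n i" by (auto simp: D b_def)
        then show "urn_stopped (urn_matrix r \<alpha> p) r (\<lambda>j. nat (int (b j) + urn_matrix r \<alpha> p i j)) =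
            spmf_of_pmf (q i)"
          unfolding b_def by (simp only: urn_matrix_add_units q(1)[OF i])
      qed
      also have "\<dots> = spmf_of_pmf (bind_pmf (urn_draw r b) q)"
        by (simp add: spmf_of_pmf_bind)
      finally have 1: "urn_stopped (urn_matrix r \<alpha> p) r b = spmf_of_pmf (bind_pmf (urn_draw r b) q)" .
      have finD: "finite D" by (simp add: D)
      have 2: "finite (set_pmf (bind_pmf (urn_draw r b) q))"
        using finD q(2) by (simp add: D_def)
      have "measure_pmf.expectation (bind_pmf (urn_draw r b) q) \<phi> =
          (\<Sum>i\<in>D. pmf (urn_draw r b) i *\<^sub>R measure_pmf.expectation (q i) \<phi>)"
        using q(2) finD by (intro pmf_expectation_bind) (auto simp: D_def)
      also have "\<dots> = (\<Sum>i\<in>D. (real (\<alpha> i * n i) / real N) *\<^sub>R J (unit_step p n i))"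
        using N D by (intro sum.cong) (simp_all add: q(3) pmf_urn_draw N_def b_def)
      \<comment> \<open>Types without balls may be added back, since their probability is 0; this
        covers the truncated values of \<open>unit_step\<close>.\<close>
      also have "\<dots> = (\<Sum>i=1..r. (real (\<alpha> i * n i) / real N) *\<^sub>R J (unit_step p n i))"
        by (intro sum.mono_neutral_left) (auto simp: D b_def)
      also have "\<dots> = (1 / real N) *\<^sub>R (\<Sum>i=1..r. real (\<alpha> i * n i) *\<^sub>R J (unit_step p n i))"
        by (simp add: scaleR_sum_right)
      also have "\<dots> = (1 / real N) *\<^sub>R (real N *\<^sub>R J n)"
        using rec[of n] False by (simp add: N_def)
      also have "\<dots> = J n"
        using N by simp
      finally show ?thesis using 1 2 unfolding b_def by blast
    qed
  qed
  then show ?thesis by auto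
qed

section \<open>Differential equations and bounds for the functions \<open>urn_f\<close>\<close>

text \<open>Substituting w = t - u and splitting exp(-a(t - w)) removes t from the integrand, so
  that it survives only in a factor and in the upper limit. The result is a gauge integral, ready
  for the fundamental theorem of calculus.\<close>

lemma urn_f_Suc_eq_integral:
  assumes cont: "continuous_on {0..} (urn_f \<alpha> p v j)" and t: "0 \<le> t"
  shows "urn_f \<alpha> p v (Suc j) t =
    complex_of_real (exp (- real (\<alpha> (Suc j)) * t)) *
    (v (Suc j) + integral {0..t} (\<lambda>w. complex_of_real (real (\<alpha> (Suc j)) * exp (real (\<alpha> (Suc j)) * w)) *
        urn_f \<alpha> p v j w ^ p (Suc j)))"
proof -
  define a where "a = real (\<alpha> (Suc j))"
  define q where "q = (\<lambda>w. complex_of_real (a * exp (a * w)) * urn_f \<alpha> p v j w ^ p (Suc j))"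
  have c: "continuous_on {0..t} (urn_f \<alpha> p v j)"
    using cont by (rule continuous_on_subset) auto
  have cq: "continuous_on {0..t} q"
    unfolding q_def by (intro continuous_intros c)
  have "(LINT u:{0..t}|lborel. complex_of_real (a * exp (- a * u)) * urn_f \<alpha> p v j (t - u) ^ p (Suc j))
      = (LINT w:{0..t}|lborel. complex_of_real (exp (- a * t)) * q w)"
    unfolding set_lebesgue_integral_def
    by (subst lborel_integral_real_affine[where c = "-1" and t = t])
       (auto intro!: Bochner_Integration.integral_cong
          simp: indicator_def q_def algebra_simps simp flip: exp_add of_real_mult)
  also have "\<dots> = complex_of_real (exp (- a * t)) * (LINT w:{0..t}|lborel. q w)"
    by simp
  also have "(LINT w:{0..t}|lborel. q w) = integral {0..t} q"
    by (intro set_borel_integral_eq_integral(2) borel_integrable_atLeastAtMost' cq)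
  finally show ?thesis
    by (simp add: a_def q_def algebra_simps)
qed

text \<open>Product rule and fundamental theorem, applied to the preceding formula. Continuity of
  the level below is assumed because continuity of all levels is derived from this lemma by
  induction; \<open>urn_f_has_vector_derivative\<close> is the unconditional form.\<close>

lemma urn_f_has_vector_derivative_if_continuous:
  assumes cont: "continuous_on {0..} (urn_f \<alpha> p v j)" and t: "0 \<le> t"
  shows "(urn_f \<alpha> p v (Suc j) has_vector_derivative
      of_nat (\<alpha> (Suc j)) * (urn_f \<alpha> p v j t ^ p (Suc j) - urn_f \<alpha> p v (Suc j) t)) (at t within {0..})"
proof -
  define a where "a = real (\<alpha> (Suc j))"
  define q where "q = (\<lambda>w. complex_of_real (a * exp (a * w)) * urn_f \<alpha> p v j w ^ p (Suc j))"
  have eq: "urn_f \<alpha> p v (Suc j) s = complex_of_real (exp (- a * s)) * (v (Suc j) + integral {0..s} q)"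
    if "0 \<le> s" for s
    using urn_f_Suc_eq_integral[OF cont that] by (simp add: a_def q_def)
  have cq: "continuous_on {0..t+1} q"
    unfolding q_def
    by (intro continuous_intros continuous_on_subset[OF cont]) auto
  \<comment> \<open>The fundamental theorem is applied on a compact interval; any right end beyond
    \<open>t\<close> gives the same filter at \<open>t\<close>.\<close>
  have "at t within {0..t+1} = at t within {0..}"
    by (rule at_within_nhd[of _ "{..<t+1}"]) auto
  then have "((\<lambda>s. integral {0..s} q) has_vector_derivative q t) (at t within {0..})"
    using integral_has_vector_derivative[OF cq, of t] t by simp
  moreover have "((\<lambda>s. complex_of_real (exp (- a * s))) has_vector_derivative
      complex_of_real (- a * exp (- a * t))) (at t within {0..})"
    by (intro has_vector_derivative_of_real)
       (auto intro!: derivative_eq_intros simp flip: has_real_derivative_iff_has_vector_derivative)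
  ultimately have "((\<lambda>s. complex_of_real (exp (- a * s)) * (v (Suc j) + integral {0..s} q)) has_vector_derivative
      complex_of_real (exp (- a * t)) * (0 + q t) +
      complex_of_real (- a * exp (- a * t)) * (v (Suc j) + integral {0..t} q)) (at t within {0..})"
    by (intro has_vector_derivative_mult has_vector_derivative_add has_vector_derivative_const)
  moreover have "complex_of_real (exp (- a * t)) * (0 + q t) +
      complex_of_real (- a * exp (- a * t)) * (v (Suc j) + integral {0..t} q)
      = of_nat (\<alpha> (Suc j)) * (urn_f \<alpha> p v j t ^ p (Suc j) - urn_f \<alpha> p v (Suc j) t)"
    unfolding eq[OF t] by (simp add: q_def a_def algebra_simps exp_minus field_simps)
  ultimately show ?thesis
    using eq t by (auto intro: has_vector_derivative_transform[rotated 2])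
qed

lemma continuous_on_urn_f: "continuous_on {0..} (urn_f \<alpha> p v j)"
proof (induction j)
  case (Suc j)
  show ?case
    unfolding continuous_on_eq_continuous_within
    using urn_f_has_vector_derivative_if_continuous[OF Suc] has_vector_derivative_continuous by fastforce
qed simp

lemmas urn_f_has_vector_derivative =
  urn_f_has_vector_derivative_if_continuous[OF continuous_on_urn_f]

lemma urn_f_at_0: "1 \<le> j \<Longrightarrow> urn_f \<alpha> p v j 0 = v j"
  using urn_f_Suc_eq_integral[OF continuous_on_urn_f, of 0] by (cases j) auto

lemma urn_f_bounded: "\<exists>B. \<forall>t\<ge>0. norm (urn_f \<alpha> p v j t) \<le> B"
proof (induction j)
  case (Suc j)
  then obtain B where B: "\<And>t. 0 \<le> t \<Longrightarrow> norm (urn_f \<alpha> p v j t) \<le> B" by blast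
  then have B0: "0 \<le> B" using norm_ge_zero order_trans by blast
  define a where "a = real (\<alpha> (Suc j))"
  define q where "q = (\<lambda>w. complex_of_real (a * exp (a * w)) * urn_f \<alpha> p v j w ^ p (Suc j))"
  have "norm (urn_f \<alpha> p v (Suc j) t) \<le> norm (v (Suc j)) + B ^ p (Suc j)" if t: "0 \<le> t" for t
  proof -
    have cq: "continuous_on {0..t} q"
      unfolding q_def
      by (intro continuous_intros continuous_on_subset[OF continuous_on_urn_f]) auto
    have hi: "((\<lambda>w. B ^ p (Suc j) * (a * exp (a * w))) has_integral B ^ p (Suc j) * (exp (a * t) - exp (a * 0))) {0..t}"
      by (intro has_integral_mult_right fundamental_theorem_of_calculus t)
         (auto intro!: derivative_eq_intros simp flip: has_real_derivative_iff_has_vector_derivative)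
    have "norm (integral {0..t} q) \<le> integral {0..t} (\<lambda>w. B ^ p (Suc j) * (a * exp (a * w)))"
    proof (rule integral_norm_bound_integral)
      show "q integrable_on {0..t}" by (intro integrable_continuous_real cq)
      show "(\<lambda>w. B ^ p (Suc j) * (a * exp (a * w))) integrable_on {0..t}" using hi by blast
      show "norm (q w) \<le> B ^ p (Suc j) * (a * exp (a * w))" if "w \<in> {0..t}" for w
        using mult_right_mono[OF power_mono[OF B[of w]], of "a * exp (a * w)" "p (Suc j)"] that
        by (simp add: q_def norm_mult norm_power a_def abs_mult mult.commute)
    qed
    also have "\<dots> = B ^ p (Suc j) * (exp (a * t) - 1)"
      using integral_unique[OF hi] by simp
    finally have 1: "norm (integral {0..t} q) \<le> B ^ p (Suc j) * (exp (a * t) - 1)" .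
    have "norm (urn_f \<alpha> p v (Suc j) t) = exp (- a * t) * norm (v (Suc j) + integral {0..t} q)"
      unfolding urn_f_Suc_eq_integral[OF continuous_on_urn_f t] a_def q_def by (simp add: norm_mult)
    also have "\<dots> \<le> exp (- a * t) * (norm (v (Suc j)) + B ^ p (Suc j) * (exp (a * t) - 1))"
      using 1 norm_triangle_ineq[of "v (Suc j)" "integral {0..t} q"] by (intro mult_left_mono) auto
    also have "\<dots> = exp (- a * t) * norm (v (Suc j)) + B ^ p (Suc j) * (1 - exp (- a * t))"
      by (simp add: algebra_simps exp_minus field_simps)
    also have "\<dots> \<le> 1 * norm (v (Suc j)) + B ^ p (Suc j) * 1"
      using t B0 by (intro add_mono mult_right_mono mult_left_mono) (auto simp: a_def)
    finally show ?thesis by simp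
  qed
  then show ?case by blast
qed (auto intro: exI[of _ 1])

text \<open>By the product rule and the differential equations, differentiating the monomial lets
  one unit die: type \<open>l\<close> does so at total rate \<open>\<alpha> l * m l\<close>. This is
  the generator of the continuous-time process acting on the exponents.\<close>

lemma urn_f_prod_has_vector_derivative:
  assumes t: "0 \<le> t"
  shows "((\<lambda>t. \<Prod>l=1..r. urn_f \<alpha> p v l t ^ m l) has_vector_derivative
      (\<Sum>l=1..r. of_nat (\<alpha> l * m l) * ((\<Prod>j=1..r. urn_f \<alpha> p v j t ^ unit_step p m l j) -
        (\<Prod>j=1..r. urn_f \<alpha> p v j t ^ m j)))) (at t within {0..})"
proof -
  let ?f = "urn_f \<alpha> p v"
  define d where "d l = of_nat (\<alpha> l) * (?f (l - 1) t ^ p l - ?f l t)" for l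
  have d: "(?f l has_derivative (\<lambda>y. y *\<^sub>R d l)) (at t within {0..})" if "l \<in> {1..r}" for l
    using urn_f_has_vector_derivative[OF t, of \<alpha> p v "l - 1"] that
    by (simp add: d_def has_vector_derivative_def del: urn_f.simps)
  have "((\<lambda>t. \<Prod>l=1..r. ?f l t ^ m l) has_derivative
      (\<lambda>y. \<Sum>l=1..r. (of_nat (m l) * (y *\<^sub>R d l) * ?f l t ^ (m l - 1)) *
        (\<Prod>j\<in>{1..r} - {l}. ?f j t ^ m j))) (at t within {0..})"
    by (intro has_derivative_prod has_derivative_power d)
  also have "(\<lambda>y. \<Sum>l=1..r. (of_nat (m l) * (y *\<^sub>R d l) * ?f l t ^ (m l - 1)) *
        (\<Prod>j\<in>{1..r} - {l}. ?f j t ^ m j)) =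
      (\<lambda>y. y *\<^sub>R (\<Sum>l=1..r. of_nat (\<alpha> l * m l) * ((\<Prod>j=1..r. ?f j t ^ unit_step p m l j) -
        (\<Prod>j=1..r. ?f j t ^ m j))))"
    unfolding scaleR_sum_right
  proof (intro ext sum.cong refl)
    fix y :: real and l assume l: "l \<in> {1..r}"
    have 1: "(\<Prod>j=1..r. ?f j t ^ unit_step p m l j) =
        ?f l t ^ (m l - 1) * ?f (l - 1) t ^ p l * (\<Prod>j\<in>{1..r} - {l}. ?f j t ^ m j)"
      using l by (intro prod_unit_step) auto
    have 2: "(\<Prod>j=1..r. ?f j t ^ m j) = ?f l t ^ m l * (\<Prod>j\<in>{1..r} - {l}. ?f j t ^ m j)"
      using l by (intro prod.remove) auto
    show "(of_nat (m l) * (y *\<^sub>R d l) * ?f l t ^ (m l - 1)) * (\<Prod>j\<in>{1..r} - {l}. ?f j t ^ m j) =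
        y *\<^sub>R (of_nat (\<alpha> l * m l) * ((\<Prod>j=1..r. ?f j t ^ unit_step p m l j) -
          (\<Prod>j=1..r. ?f j t ^ m j)))"
      \<comment> \<open>If \<open>m l = 0\<close> both sides vanish; otherwise one power of the
        factor is split off.\<close>
      unfolding 1 2 d_def by (cases "m l") (simp_all add: scaleR_conv_of_real algebra_simps)
  qed
  finally show ?thesis by (simp add: has_vector_derivative_def)
qed

section \<open>The kernel and the recurrence for its integral\<close>

text \<open>Here \<open>m\<close> lists all initial units except one of type \<open>r\<close>, and
  the exponential is the probability that this unit is still alive at time \<open>t\<close>. With
  \<open>v r = 0\<close> the other units of type \<open>r\<close> are forced to have died, making
  the singled-out unit the last one.\<close>

definition urn_kernel ::
  "nat \<Rightarrow> (nat \<Rightarrow> nat) \<Rightarrow> (nat \<Rightarrow> nat) \<Rightarrow> (nat \<Rightarrow> complex) \<Rightarrow> (nat \<Rightarrow> nat) \<Rightarrow> real \<Rightarrow> complex" where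
  "urn_kernel r \<alpha> p v m t =
     complex_of_real (exp (- real (\<alpha> r) * t)) * (\<Prod>l=1..r. urn_f \<alpha> p v l t ^ m l)"

lemma continuous_on_urn_kernel: "continuous_on {0..} (urn_kernel r \<alpha> p v m)"
  unfolding urn_kernel_def[abs_def] by (intro continuous_intros continuous_on_urn_f)

lemma urn_kernel_bounded:
  "\<exists>B\<ge>0. \<forall>t\<ge>0. norm (urn_kernel r \<alpha> p v m t) \<le> B * exp (- (t * real (\<alpha> r)))"
proof -
  obtain B where B: "\<And>l t. 0 \<le> t \<Longrightarrow> norm (urn_f \<alpha> p v l t) \<le> B l"
    using urn_f_bounded[of \<alpha> p v] by metis
  have B0: "0 \<le> B l" for l using B[of 0 l] norm_ge_zero order_trans by blast
  have "norm (\<Prod>l=1..r. urn_f \<alpha> p v l t ^ m l) \<le> (\<Prod>l=1..r. B l ^ m l)" if "0 \<le> t" for t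
    unfolding prod_norm[symmetric] norm_power
    using B[OF that] by (intro prod_mono conjI power_mono zero_le_power) auto
  then show ?thesis
    by (intro exI[of _ "\<Prod>l=1..r. B l ^ m l"])
       (auto simp: urn_kernel_def norm_mult prod_nonneg B0 mult.commute intro!: mult_right_mono)
qed

lemma set_integrable_urn_kernel:
  assumes "1 \<le> \<alpha> r"
  shows "set_integrable lborel {0<..} (urn_kernel r \<alpha> p v m)"
proof -
  obtain B where B: "\<And>t. 0 \<le> t \<Longrightarrow> norm (urn_kernel r \<alpha> p v m t) \<le> B * exp (- (t * real (\<alpha> r)))"
    using urn_kernel_bounded by metis
  have "set_integrable lborel {0<..} (\<lambda>t. exp (- (t * real (\<alpha> r))))"
    using assms by (intro integrable_I0i_exp_mscale) auto
  then have "set_integrable lborel {0<..} (\<lambda>t. B * exp (- (t * real (\<alpha> r))))"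
    by (intro set_integrable_mult_right)
  moreover have "set_borel_measurable lborel {0<..} (urn_kernel r \<alpha> p v m)"
    unfolding set_borel_measurable_def
    using borel_measurable_continuous_on_indicator[OF _ continuous_on_subset[OF continuous_on_urn_kernel]]
    by (simp add: subset_eq)
  ultimately show ?thesis
    by (rule set_integrable_bound) (use B in \<open>auto intro!: order_trans[OF B] simp: abs_mult\<close>)
qed

text \<open>The open half-line matches the interval integral from 0 to \<infinity> used for the
  fundamental theorem; the passage to \<open>{0..}\<close> comes at the end.\<close>

definition urn_kernel_integral ::
  "nat \<Rightarrow> (nat \<Rightarrow> nat) \<Rightarrow> (nat \<Rightarrow> nat) \<Rightarrow> (nat \<Rightarrow> complex) \<Rightarrow> (nat \<Rightarrow> nat) \<Rightarrow> complex" where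
  "urn_kernel_integral r \<alpha> p v m = (LINT t:{0<..}|lborel. urn_kernel r \<alpha> p v m t)"

text \<open>The exponential adds \<open>\<alpha> r\<close> to the total rate, which becomes the
  number of balls in \<open>m\<close> together with the singled-out unit.\<close>

lemma urn_kernel_has_vector_derivative:
  assumes t: "0 < t"
  shows "(urn_kernel r \<alpha> p v m has_vector_derivative
      (\<Sum>l=1..r. of_nat (\<alpha> l * m l) * urn_kernel r \<alpha> p v (unit_step p m l) t) -
      of_nat ((\<Sum>l=1..r. \<alpha> l * m l) + \<alpha> r) * urn_kernel r \<alpha> p v m t) (at t)"
proof -
  let ?E = "\<lambda>t. complex_of_real (exp (- real (\<alpha> r) * t))"
  let ?F = "\<lambda>m t. \<Prod>l=1..r. urn_f \<alpha> p v l t ^ m l"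
  have at: "at t within {0..} = at t" by (rule at_within_interior) (use t in simp)
  have E: "(?E has_vector_derivative complex_of_real (- real (\<alpha> r) * exp (- real (\<alpha> r) * t))) (at t)"
    by (intro has_vector_derivative_of_real)
       (auto intro!: derivative_eq_intros simp flip: has_real_derivative_iff_has_vector_derivative)
  have "(?F m has_vector_derivative (\<Sum>l=1..r. of_nat (\<alpha> l * m l) * (?F (unit_step p m l) t - ?F m t))) (at t)"
    using urn_f_prod_has_vector_derivative[of t] t unfolding at by simp
  from has_vector_derivative_mult[OF E this]
  have "(urn_kernel r \<alpha> p v m has_vector_derivative
      ?E t * (\<Sum>l=1..r. of_nat (\<alpha> l * m l) * (?F (unit_step p m l) t - ?F m t)) +
      complex_of_real (- real (\<alpha> r) * exp (- real (\<alpha> r) * t)) * ?F m t) (at t)"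
    by (simp add: urn_kernel_def[abs_def])
  also have "?E t * (\<Sum>l=1..r. of_nat (\<alpha> l * m l) * (?F (unit_step p m l) t - ?F m t)) =
      (\<Sum>l=1..r. of_nat (\<alpha> l * m l) * (?E t * ?F (unit_step p m l) t)) -
      (\<Sum>l=1..r. of_nat (\<alpha> l * m l)) * (?E t * ?F m t)"
    unfolding sum_distrib_left sum_distrib_right sum_subtractf[symmetric]
    by (intro sum.cong refl) (simp only: right_diff_distrib mult_ac)
  finally show ?thesis
    unfolding urn_kernel_def of_nat_add of_nat_sum by (rule has_vector_derivative_eq_rhs) (simp add: algebra_simps)
qed

text \<open>Integrating the derivative over the half-line leaves minus the value at 0, since the
  kernel decays at infinity. As \<open>urn_f\<close> starts in \<open>v l\<close>, that value is the
  monomial on the right.\<close>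

lemma urn_kernel_integral_rec:
  assumes \<alpha>: "1 \<le> \<alpha> r"
  shows "of_nat ((\<Sum>l=1..r. \<alpha> l * m l) + \<alpha> r) * urn_kernel_integral r \<alpha> p v m =
    (\<Prod>l=1..r. v l ^ m l) + (\<Sum>l=1..r. of_nat (\<alpha> l * m l) * urn_kernel_integral r \<alpha> p v (unit_step p m l))"
proof -
  let ?K = "urn_kernel r \<alpha> p v"
  let ?D = "\<lambda>t. (\<Sum>l=1..r. of_nat (\<alpha> l * m l) * ?K (unit_step p m l) t) -
      of_nat ((\<Sum>l=1..r. \<alpha> l * m l) + \<alpha> r) * ?K m t"
  note int = set_integrable_urn_kernel[where p = p and v = v and \<alpha> = \<alpha> and r = r, OF \<alpha>]
  have int1: "set_integrable lborel {0<..} (\<lambda>t. c * ?K m t)" for c m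
    by (intro set_integrable_mult_right int)
  have intS: "set_integrable lborel {0<..} (\<lambda>t. \<Sum>l=1..r. of_nat (\<alpha> l * m l) * ?K (unit_step p m l) t)"
    using int1 unfolding set_integrable_def scaleR_sum_right by (intro Bochner_Integration.integrable_sum)
  have "(LBINT t=0..\<infinity>. ?D t) = 0 - ?K m 0"
  proof (rule interval_integral_FTC_integrable[where F = "?K m"])
    fix t assume "(0::ereal) < ereal t"
    then have t: "0 < t" by simp
    show "(?K m has_vector_derivative ?D t) (at t)"
      by (rule urn_kernel_has_vector_derivative[OF t])
    have "isCont (?K m) t" for m
      using continuous_on_interior[OF continuous_on_urn_kernel, of t] t by simp
    then show "isCont ?D t" by (intro continuous_intros)
  next
    show "set_integrable lborel (einterval 0 \<infinity>) ?D"
      unfolding zero_ereal_def einterval_eq by (intro set_integral_diff intS int1)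
    have "(?K m \<longlongrightarrow> ?K m 0) (at_right 0)"
      using continuous_on_urn_kernel[of r \<alpha> p v m]
      by (simp add: continuous_on_def) (meson atLeast_iff greaterThan_iff less_imp_le order_refl subsetI tendsto_within_subset)
    then show "((?K m \<circ> real_of_ereal) \<longlongrightarrow> ?K m 0) (at_right 0)"
      by (simp add: zero_ereal_def ereal_tendsto_simps)
    obtain B where B: "\<And>t. 0 \<le> t \<Longrightarrow> norm (?K m t) \<le> B * exp (- (t * real (\<alpha> r)))"
      using urn_kernel_bounded by metis
    have "((\<lambda>t. B * exp (- (t * real (\<alpha> r)))) \<longlongrightarrow> 0) at_top"
      using \<alpha> by (intro tendsto_mult_right_zero) real_asymp
    then have "(?K m \<longlongrightarrow> 0) at_top"
      by (rule Lim_null_comparison[rotated]) (use B in \<open>auto intro: eventually_mono[OF eventually_ge_at_top[of 0]]\<close>)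
    then show "((?K m \<circ> real_of_ereal) \<longlongrightarrow> 0) (at_left \<infinity>)"
      by (simp add: ereal_tendsto_simps)
  qed simp
  moreover have "(LBINT t=0..\<infinity>. ?D t) =
      (\<Sum>l=1..r. of_nat (\<alpha> l * m l) * urn_kernel_integral r \<alpha> p v (unit_step p m l)) -
      of_nat ((\<Sum>l=1..r. \<alpha> l * m l) + \<alpha> r) * urn_kernel_integral r \<alpha> p v m"
  proof -
    have "(LBINT t:{0<..}. \<Sum>l=1..r. of_nat (\<alpha> l * m l) * ?K (unit_step p m l) t) =
        (\<Sum>l=1..r. LBINT t:{0<..}. of_nat (\<alpha> l * m l) * ?K (unit_step p m l) t)"
      using int1 unfolding set_lebesgue_integral_def set_integrable_def scaleR_sum_right
      by (intro Bochner_Integration.integral_sum)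
    then show ?thesis
      unfolding interval_lebesgue_integral_0_infty urn_kernel_integral_def
      by (subst set_integral_diff(2)[OF intS int1]) simp
  qed
  moreover have "?K m 0 = (\<Prod>l=1..r. v l ^ m l)"
    by (simp add: urn_kernel_def urn_f_at_0)
  ultimately show ?thesis by (simp add: algebra_simps)
qed

section \<open>The claimed integral as a solution of the one-step equation\<close>

lemma urn_f_cong: "(\<And>l. 1 \<le> l \<Longrightarrow> l \<le> j \<Longrightarrow> v l = w l) \<Longrightarrow> urn_f \<alpha> p v j = urn_f \<alpha> p w j"
  by (induction j) auto

text \<open>The variable \<open>v j\<close> enters level \<open>j\<close> only through the term that
  \<open>urn_g\<close> subtracts. Hence g_r is an instance of f_r and inherits its differential
  equation.\<close>

lemma urn_f_upd_zero: "1 \<le> j \<Longrightarrow> urn_f \<alpha> p (v(j := 0)) j t = urn_g \<alpha> p v j t"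
  using urn_f_cong[of "j - 1" "v(j := 0)" v \<alpha> p] by (cases j) (auto simp: urn_g_def)

text \<open>The candidate for \<open>J\<close> in the uniqueness lemma. The stopping value needs its
  own case: the integral formula would give 0 there, owing to the factor \<open>n r\<close>.\<close>

definition urn_expectation ::
  "nat \<Rightarrow> (nat \<Rightarrow> nat) \<Rightarrow> (nat \<Rightarrow> nat) \<Rightarrow> (nat \<Rightarrow> complex) \<Rightarrow> (nat \<Rightarrow> nat) \<Rightarrow> complex" where
  "urn_expectation r \<alpha> p v n =
     (if n r = 0 then \<Prod>l = 1..r - 1. v l ^ n l
      else of_nat (\<alpha> r * n r) * v (r - 1) ^ p r *
        urn_kernel_integral r \<alpha> p (v(r := 0)) (n(r := n r - 1)))"

text \<open>With \<open>m\<close> as \<open>n\<close> less one unit of type \<open>r\<close>, this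
  is \<open>urn_kernel_integral_rec\<close> for \<open>m\<close> times the constant
  \<open>c\<close>. Draws of lower types commute with the removal and preserve \<open>c\<close>; the
  draw of type \<open>r\<close> accounts for the monomial.\<close>

lemma urn_expectation_rec:
  assumes r: "2 \<le> r" and \<alpha>: "1 \<le> \<alpha> r" and n: "1 \<le> n r"
  shows "of_nat (\<Sum>i=1..r. \<alpha> i * n i) * urn_expectation r \<alpha> p v n =
    (\<Sum>i=1..r. of_nat (\<alpha> i * n i) * urn_expectation r \<alpha> p v (unit_step p n i))"
proof -
  define m where "m = n(r := n r - 1)"
  define A where "A = urn_kernel_integral r \<alpha> p (v(r := 0))"
  define c where "c = of_nat (\<alpha> r * n r) * v (r - 1) ^ p r"
  have split: "(\<Sum>i=1..r. g i) = (\<Sum>i=1..r-1. g i) + g r" for g :: "nat \<Rightarrow> 'b::comm_monoid_add"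
    using r by (cases r) auto
  have "(\<Sum>i=1..r-1. \<alpha> i * n i) = (\<Sum>i=1..r-1. \<alpha> i * m i)"
    using r by (intro sum.cong) (auto simp: m_def)
  then have N: "(\<Sum>i=1..r. \<alpha> i * n i) = (\<Sum>i=1..r. \<alpha> i * m i) + \<alpha> r"
    unfolding split using n by (cases "n r") (auto simp: m_def)
  have low: "of_nat (\<alpha> i * n i) * urn_expectation r \<alpha> p v (unit_step p n i) =
      c * (of_nat (\<alpha> i * m i) * A (unit_step p m i))" if i: "i \<in> {1..r-1}" for i
  proof -
    have "unit_step p n i r = n r" "m i = n i" using i by (auto simp: unit_step_def m_def)
    moreover have "(unit_step p n i)(r := n r - 1) = unit_step p m i"
      using i by (auto simp: unit_step_def m_def fun_eq_iff)
    ultimately show ?thesis using n by (simp add: urn_expectation_def A_def c_def)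
  qed
  \<comment> \<open>The monomial contains \<open>0 ^ m r\<close>. It survives only for
    \<open>m r = 0\<close>, where \<open>0 ^ 0 = 1\<close>: the last unit of type \<open>r\<close>
    is drawn and the urn stops. Otherwise it vanishes, and the new constant supplies the factor
    \<open>n r - 1 = m r\<close>.\<close>
  have top: "of_nat (\<alpha> r * n r) * urn_expectation r \<alpha> p v (unit_step p n r) =
      c * ((\<Prod>l=1..r. (v(r := 0)) l ^ m l) + of_nat (\<alpha> r * m r) * A (unit_step p m r))"
  proof (cases "n r = 1")
    case True
    have ul: "{Suc 0..r} - {r} = {Suc 0..r - Suc 0}" by auto
    have "urn_expectation r \<alpha> p v (unit_step p n r) = (\<Prod>l=1..r-1. v l ^ unit_step p n r l)"
      using True by (simp add: urn_expectation_def unit_step_def)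
    also have "\<dots> = (\<Prod>l=1..r. v l ^ unit_step p n r l)"
      using r True by (subst prod.remove[of "{1..r}" r]) (auto simp: ul unit_step_def)
    also have "\<dots> = v (r - 1) ^ p r * (\<Prod>l=1..r-1. v l ^ n l)"
      using r True by (subst prod_unit_step) (auto simp: ul)
    also have "(\<Prod>l=1..r-1. v l ^ n l) = (\<Prod>l=1..r-1. (v(r := 0)) l ^ m l)"
      using r by (intro prod.cong) (auto simp: m_def)
    also have "\<dots> = (\<Prod>l=1..r. (v(r := 0)) l ^ m l)"
      using r True by (subst prod.remove[of "{1..r}" r]) (auto simp: ul m_def)
    finally show ?thesis using True by (simp add: c_def m_def)
  next
    case False
    then have n2: "2 \<le> n r" using n by simp
    have "(unit_step p n r)(r := n r - 1 - 1) = unit_step p m r"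
      using n2 r by (auto simp: unit_step_def m_def fun_eq_iff)
    moreover have "unit_step p n r r = n r - 1" "m r = n r - 1" by (auto simp: unit_step_def m_def)
    moreover have "(\<Prod>l=1..r. (v(r := 0)) l ^ m l) = 0"
      using r n2 by (intro prod_zero) (auto simp: m_def intro!: bexI[of _ r])
    ultimately show ?thesis using n2 by (simp add: urn_expectation_def A_def c_def)
  qed
  have lows: "(\<Sum>i=1..r-1. of_nat (\<alpha> i * n i) * urn_expectation r \<alpha> p v (unit_step p n i)) =
      (\<Sum>i=1..r-1. c * (of_nat (\<alpha> i * m i) * A (unit_step p m i)))"
    by (intro sum.cong refl low)
  have "of_nat (\<Sum>i=1..r. \<alpha> i * n i) * urn_expectation r \<alpha> p v n =
      c * (of_nat ((\<Sum>i=1..r. \<alpha> i * m i) + \<alpha> r) * A m)"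
    using n unfolding N by (simp add: urn_expectation_def c_def A_def m_def)
  also have "\<dots> = c * ((\<Prod>l=1..r. (v(r := 0)) l ^ m l) +
      (\<Sum>i=1..r. of_nat (\<alpha> i * m i) * A (unit_step p m i)))"
    unfolding A_def by (subst urn_kernel_integral_rec) (use \<alpha> in simp_all)
  also have "\<dots> = (\<Sum>i=1..r. of_nat (\<alpha> i * n i) * urn_expectation r \<alpha> p v (unit_step p n i))"
    unfolding split top lows by (simp add: algebra_simps sum_distrib_left)
  finally show ?thesis .
qed

lemma urn_expectation_eq_integral:
  assumes r: "2 \<le> r" and n: "1 \<le> n r"
  shows "urn_expectation r \<alpha> p v n =
    (LINT t:{0..}|lborel.
       urn_g \<alpha> p v r t ^ (n r - 1) * v (r - 1) ^ p r *
       complex_of_real (real (\<alpha> r) * real (n r) * exp (- real (\<alpha> r) * t)) *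
       (\<Prod>l = 1..r - 1. urn_f \<alpha> p v l t ^ n l))"
proof -
  have ul: "{Suc 0..r} - {r} = {Suc 0..r - Suc 0}" by auto
  have f: "urn_f \<alpha> p (v(r := 0)) l = urn_f \<alpha> p v l" if "l \<in> {1..r-1}" for l
    using that by (intro urn_f_cong) auto
  have "urn_expectation r \<alpha> p v n = (LINT t:{0<..}|lborel. of_nat (\<alpha> r * n r) * v (r - 1) ^ p r *
      urn_kernel r \<alpha> p (v(r := 0)) (n(r := n r - 1)) t)"
    using n by (simp add: urn_expectation_def urn_kernel_integral_def)
  also have "\<dots> = (LINT t:{0<..}|lborel.
       urn_g \<alpha> p v r t ^ (n r - 1) * v (r - 1) ^ p r *
       complex_of_real (real (\<alpha> r) * real (n r) * exp (- real (\<alpha> r) * t)) *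
       (\<Prod>l = 1..r - 1. urn_f \<alpha> p v l t ^ n l))"
  proof (rule set_lebesgue_integral_cong, simp, intro allI impI)
    fix t :: real
    have "(\<Prod>l=1..r. urn_f \<alpha> p (v(r := 0)) l t ^ (n(r := n r - 1)) l) =
        urn_g \<alpha> p v r t ^ (n r - 1) * (\<Prod>l=1..r - 1. urn_f \<alpha> p (v(r := 0)) l t ^ (n(r := n r - 1)) l)"
      using r by (subst prod.remove[of "{1..r}" r]) (auto simp: ul urn_f_upd_zero)
    also have "(\<Prod>l=1..r - 1. urn_f \<alpha> p (v(r := 0)) l t ^ (n(r := n r - 1)) l) =
        (\<Prod>l=1..r - 1. urn_f \<alpha> p v l t ^ n l)"
      using r by (intro prod.cong) (auto simp: f)
    finally show "of_nat (\<alpha> r * n r) * v (r - 1) ^ p r * urn_kernel r \<alpha> p (v(r := 0)) (n(r := n r - 1)) t =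
       urn_g \<alpha> p v r t ^ (n r - 1) * v (r - 1) ^ p r *
       complex_of_real (real (\<alpha> r) * real (n r) * exp (- real (\<alpha> r) * t)) *
       (\<Prod>l = 1..r - 1. urn_f \<alpha> p v l t ^ n l)"
      unfolding urn_kernel_def by (simp only: of_real_mult of_nat_mult of_real_of_nat_eq mult_ac)
  qed
  also have "\<dots> = (LINT t:{0..}|lborel.
       urn_g \<alpha> p v r t ^ (n r - 1) * v (r - 1) ^ p r *
       complex_of_real (real (\<alpha> r) * real (n r) * exp (- real (\<alpha> r) * t)) *
       (\<Prod>l = 1..r - 1. urn_f \<alpha> p v l t ^ n l))"
    \<comment> \<open>The two domains differ by the null set \<open>{0}\<close>.\<close>
    by (rule set_integral_discrete_difference[where X = "{0}"]) auto
  finally show ?thesis .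
qed

theorem theorem3:
  fixes r :: nat and \<alpha> p n :: "nat \<Rightarrow> nat" and v :: "nat \<Rightarrow> complex"
  assumes "2 \<le> r"
    and "\<And>i. i \<in> {1..r} \<Longrightarrow> 1 \<le> \<alpha> i"
    and "1 \<le> n r"
  shows "urn_pgf r \<alpha> p n v =
    (LINT t:{0..}|lborel.
       urn_g \<alpha> p v r t ^ (n r - 1) * v (r - 1) ^ p r *
       complex_of_real (real (\<alpha> r) * real (n r) * exp (- real (\<alpha> r) * t)) *
       (\<Prod>l = 1..r - 1. urn_f \<alpha> p v l t ^ n l))"
proof -
  \<comment> \<open>The conversion to units moves into the integrand, so that the uniqueness lemma
    can be applied to the law of the ball counts.\<close>
  have "urn_pgf r \<alpha> p n v =
      (LINT b|measure_spmf (urn_stopped (urn_matrix r \<alpha> p) r (\<lambda>i. \<alpha> i * n i)).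
        (\<Prod>l = 1..r - 1. v l ^ (b l div \<alpha> l)))"
    by (simp add: urn_pgf_def urn_final_units_def measure_map_spmf_conv_distr integral_distr)
  also have "\<dots> = urn_expectation r \<alpha> p v n"
  proof (rule urn_stopped_expectation_unique)
    fix n :: "nat \<Rightarrow> nat"
    show "(\<Prod>l = 1..r - 1. v l ^ (\<alpha> l * n l div \<alpha> l)) = urn_expectation r \<alpha> p v n" if "n r = 0"
      \<comment> \<open>The division is exact because every \<open>\<alpha> l\<close> is
        positive.\<close>
      unfolding urn_expectation_def using that assms(2) by (auto intro!: prod.cong) fastforce
    show "real (\<Sum>i=1..r. \<alpha> i * n i) *\<^sub>R urn_expectation r \<alpha> p v n =
        (\<Sum>i=1..r. real (\<alpha> i * n i) *\<^sub>R urn_expectation r \<alpha> p v (unit_step p n i))" if "1 \<le> n r"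
      using urn_expectation_rec[of r \<alpha> n p v] that assms(1) assms(2)[of r] by (simp add: scaleR_conv_of_real)
  qed (use assms in auto)
  finally show ?thesis
    using urn_expectation_eq_integral[of r n \<alpha> p v] assms by simp
qed

end
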